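(* Let $n\ge1$. If $\phi$ is an existential first order sentence over the vocabulary $\{<\}$ expressing the property that the length of a linear order is at least $n$, then the size of $\phi$ is at least $2n-1$.
   Context: First order logic has equality; models have nonempty universe. An existential formula is one built from atomic formulas and negations of atomic formulas using only $\vee$, $\wedge$ and $\exists x_j$. The size $\mathrm{w}$ of a formula is defined by $\mathrm{w}(\phi)=1$ for atomic $\phi$, $\mathrm{w}(\neg\phi)=\mathrm{w}(\phi)$, $\mathrm{w}(\phi\vee\psi)=\mathrm{w}(\phi\wedge\psi)=\mathrm{w}(\phi)+\mathrm{w}(\psi)$, $\mathrm{w}(\exists x_j\phi)=\mathrm{w}(\phi)+1$. Linear orders are strict linear orders viewed as $\{<\}$-models; the length of a linear order is its number of elements. The sentence $\phi$ expresses that the length is at least $n$ if for every linear order, $\phi$ is true in it iff it has at least $n$ elements. *)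

theory Defs
  imports Main
begin

text \<open>
  First-order formulas with equality over the vocabulary consisting of one binary relation symbol.
  Variables are named (not de Bruijn), so a variable may be requantified.
\<close>

datatype fo =
    Equal nat nat
  | Less nat nat
  | Neg fo
  | Disj fo fo
  | Conj fo fo
  | Exists nat fo

fun free_vars :: "fo \<Rightarrow> nat set" where
  "free_vars (Equal i j) = {i, j}"
| "free_vars (Less i j) = {i, j}"
| "free_vars (Neg \<phi>) = free_vars \<phi>"
| "free_vars (Disj \<phi> \<psi>) = free_vars \<phi> \<union> free_vars \<psi>"
| "free_vars (Conj \<phi> \<psi>) = free_vars \<phi> \<union> free_vars \<psi>"
| "free_vars (Exists j \<phi>) = free_vars \<phi> - {j}"

definition sentence :: "fo \<Rightarrow> bool" where
  "sentence \<phi> \<longleftrightarrow> free_vars \<phi> = {}"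

inductive atomic :: "fo \<Rightarrow> bool" where
  "atomic (Equal i j)"
| "atomic (Less i j)"

inductive existential :: "fo \<Rightarrow> bool" where
  "atomic \<phi> \<Longrightarrow> existential \<phi>"
| "atomic \<phi> \<Longrightarrow> existential (Neg \<phi>)"
| "existential \<phi> \<Longrightarrow> existential \<psi> \<Longrightarrow> existential (Disj \<phi> \<psi>)"
| "existential \<phi> \<Longrightarrow> existential \<psi> \<Longrightarrow> existential (Conj \<phi> \<psi>)"
| "existential \<phi> \<Longrightarrow> existential (Exists j \<phi>)"

text \<open>Not to be confused with the datatype's own \<open>size\<close> function.\<close>

fun fo_size :: "fo \<Rightarrow> nat" where
  "fo_size (Equal i j) = 1"
| "fo_size (Less i j) = 1"
| "fo_size (Neg \<phi>) = fo_size \<phi>"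
| "fo_size (Disj \<phi> \<psi>) = fo_size \<phi> + fo_size \<psi>"
| "fo_size (Conj \<phi> \<psi>) = fo_size \<phi> + fo_size \<psi>"
| "fo_size (Exists j \<phi>) = fo_size \<phi> + 1"

fun sat :: "'a set \<Rightarrow> 'a rel \<Rightarrow> (nat \<Rightarrow> 'a) \<Rightarrow> fo \<Rightarrow> bool" where
  "sat A r s (Equal i j) \<longleftrightarrow> s i = s j"
| "sat A r s (Less i j) \<longleftrightarrow> (s i, s j) \<in> r"
| "sat A r s (Neg \<phi>) \<longleftrightarrow> \<not> sat A r s \<phi>"
| "sat A r s (Disj \<phi> \<psi>) \<longleftrightarrow> sat A r s \<phi> \<or> sat A r s \<psi>"
| "sat A r s (Conj \<phi> \<psi>) \<longleftrightarrow> sat A r s \<phi> \<and> sat A r s \<psi>"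
| "sat A r s (Exists j \<phi>) \<longleftrightarrow> (\<exists>a\<in>A. sat A r (s(j := a)) \<phi>)"

text \<open>
  Truth of a sentence. The truth value of a sentence does not depend on the assignment, and for
  nonempty \<open>A\<close> there is an assignment into \<open>A\<close>, so quantifying over all of them is harmless.
\<close>

definition true_in :: "'a set \<Rightarrow> 'a rel \<Rightarrow> fo \<Rightarrow> bool" where
  "true_in A r \<phi> \<longleftrightarrow> (\<forall>s. range s \<subseteq> A \<longrightarrow> sat A r s \<phi>)"

text \<open>
  The library's \<^const>\<open>strict_linear_order_on\<close> does not itself confine the relation
  to the carrier. Models have a nonempty universe.
\<close>

definition linear_order_model :: "'a set \<Rightarrow> 'a rel \<Rightarrow> bool" where
  "linear_order_model A r \<longleftrightarrow> A \<noteq> {} \<and> r \<subseteq> A \<times> A \<and> strict_linear_order_on A r"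

text \<open>The disjunct for infinite sets is needed because \<^const>\<open>card\<close> is 0 on them.\<close>

definition length_at_least :: "nat \<Rightarrow> 'a set \<Rightarrow> bool" where
  "length_at_least n A \<longleftrightarrow> infinite A \<or> n \<le> card A"

text \<open>
  HOL cannot quantify over the universes of all models inside a formula, so the models considered
  are those whose universe is a subset of the type \<open>'a\<close>. For infinite \<open>'a\<close> this includes,
  up to isomorphism, every finite and every countably infinite linear order.
\<close>

definition expresses_length_at_least :: "'a itself \<Rightarrow> nat \<Rightarrow> fo \<Rightarrow> bool" where
  "expresses_length_at_least TYPE('a) n \<phi> \<longleftrightarrow>
     (\<forall>(A :: 'a set) r. linear_order_model A r \<longrightarrow> (true_in A r \<phi> \<longleftrightarrow> length_at_least n A))"

end

theory Submission
  imports Defs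
begin

text \<open>
  Evaluate \<open>\<phi>\<close> in the order \<open>0 < \<dots> < n - 1\<close>, where it is true, choosing a true disjunct at every
  disjunction and a witness at every quantifier. Let \<open>W\<close> be the set of witnesses and \<open>E\<close> the set of
  pairs of elements compared by the literals met on the way, so \<open>|W| + |E|\<close> is at most the
  size of \<open>\<phi>\<close>. If \<open>k\<close> and \<open>k + 1\<close> are not compared, then the map identifying these two elements
  preserves every literal met, so \<open>\<phi>\<close> is true in the order of length \<open>n - 1\<close>, which is impossible.
  Hence all \<open>n - 1\<close> neighbouring pairs are compared; for \<open>n \<ge> 2\<close> these pairs involve all \<open>n\<close>
  elements, and as \<open>\<phi>\<close> is a sentence, each of them is a witness.
\<close>

lemma sat_cong_free_vars:
  assumes "\<And>i. i \<in> free_vars \<phi> \<Longrightarrow> s i = t i"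
  shows "sat A r s \<phi> \<longleftrightarrow> sat A r t \<phi>"
  using assms
proof (induction \<phi> arbitrary: s t)
  case (Exists j \<phi>)
  have "sat A r (s(j := a)) \<phi> \<longleftrightarrow> sat A r (t(j := a)) \<phi>" for a
    by (rule Exists.IH) (use Exists.prems in auto)
  then show ?case by simp
next
  case (Disj \<phi> \<psi>)
  have "sat A r s \<phi> \<longleftrightarrow> sat A r t \<phi>" "sat A r s \<psi> \<longleftrightarrow> sat A r t \<psi>"
    using Disj.prems by (auto intro!: Disj.IH)
  then show ?case by simp
next
  case (Conj \<phi> \<psi>)
  have "sat A r s \<phi> \<longleftrightarrow> sat A r t \<phi>" "sat A r s \<psi> \<longleftrightarrow> sat A r t \<psi>"
    using Conj.prems by (auto intro!: Conj.IH)
  then show ?case by simp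
next
  case (Neg \<phi>)
  have "sat A r s \<phi> \<longleftrightarrow> sat A r t \<phi>"
    using Neg.prems by (auto intro!: Neg.IH)
  then show ?case by simp
qed simp_all

lemma true_in_sentenceI:
  assumes "sentence \<phi>" "sat A r s \<phi>"
  shows "true_in A r \<phi>"
  unfolding true_in_def
proof (intro allI impI)
  fix t
  have "sat A r s \<phi> \<longleftrightarrow> sat A r t \<phi>"
    using assms(1) by (intro sat_cong_free_vars) (simp add: sentence_def)
  with assms(2) show "sat A r t \<phi>" by simp
qed

text \<open>For linear orders, the second conjunct says that \<open>h\<close> is weakly monotone.\<close>

definition collapse :: "'a set \<Rightarrow> 'a rel \<Rightarrow> ('a \<times> 'a) set \<Rightarrow> 'b set \<Rightarrow> 'b rel \<Rightarrow> ('a \<Rightarrow> 'b) \<Rightarrow> bool"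
  where "collapse A r E B r' h \<longleftrightarrow>
    h ` A \<subseteq> B \<and>
    (\<forall>a\<in>A. \<forall>b\<in>A. (h a, h b) \<in> r' \<longrightarrow> (a, b) \<in> r) \<and>
    (\<forall>(a, b)\<in>E. ((a, b) \<in> r \<longrightarrow> (h a, h b) \<in> r') \<and> (a \<noteq> b \<longrightarrow> h a \<noteq> h b))"

lemma collapse_antimono: "collapse A r E B r' h \<Longrightarrow> E' \<subseteq> E \<Longrightarrow> collapse A r E' B r' h"
  unfolding collapse_def by (meson Ball_def subsetD)

text \<open>The bound survives the induction because each literal pays for one pair in
  \<open>E\<close> and each quantifier for one witness in \<open>W\<close>. Values of free variables
  may be endpoints in \<open>E\<close>, since subformulas of a sentence need not be sentences. Under
  a collapse, \<open>Equal\<close> survives for any \<open>h\<close>, negated \<open>Less\<close> by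
  the second conjunct of \<open>collapse\<close>, \<open>Less\<close> and negated
  \<open>Equal\<close> by the third.\<close>

lemma existential_sat_support:
  fixes A :: "'a set" and s :: "nat \<Rightarrow> 'a"
  assumes "existential \<phi>" "sat A r s \<phi>" "range s \<subseteq> A"
  shows "\<exists>W E. W \<subseteq> A \<and> finite W \<and> finite E \<and> card W + card E \<le> fo_size \<phi> \<and>
    E \<subseteq> (W \<union> s ` free_vars \<phi>) \<times> (W \<union> s ` free_vars \<phi>) \<and>
    (\<forall>(B :: 'b set) r' h. collapse A r E B r' h \<longrightarrow> sat B r' (h \<circ> s) \<phi>)"
  using assms
proof (induction arbitrary: s)
  case (1 \<phi>)
  then have "s i \<in> A" for i by auto
  from 1(1) obtain i j where "\<phi> = Equal i j \<or> \<phi> = Less i j"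
    by (auto elim: atomic.cases)
  with 1(2) \<open>\<And>i. s i \<in> A\<close> show ?case
    by (intro exI[of _ "{}"] exI[of _ "{(s i, s j)}"]) (auto simp: collapse_def)
next
  case (2 \<phi>)
  then have "s i \<in> A" for i by auto
  from 2(1) obtain i j where "\<phi> = Equal i j \<or> \<phi> = Less i j"
    by (auto elim: atomic.cases)
  with 2(2) \<open>\<And>i. s i \<in> A\<close> show ?case
    by (intro exI[of _ "{}"] exI[of _ "{(s i, s j)}"]) (auto simp: collapse_def)
next
  case (3 \<phi> \<psi>)
  \<comment> \<open>Only a true disjunct contributes; the size of the other one is slack.\<close>
  then consider "sat A r s \<phi>" | "sat A r s \<psi>" by auto
  then show ?case
  proof cases
    case 1
    from 3(3)[OF 1 3(6)] obtain W E where "W \<subseteq> A" "finite W" "finite E" "card W + card E \<le> fo_size \<phi>"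
      "E \<subseteq> (W \<union> s ` free_vars \<phi>) \<times> (W \<union> s ` free_vars \<phi>)"
      "\<forall>(B :: 'b set) r' h. collapse A r E B r' h \<longrightarrow> sat B r' (h \<circ> s) \<phi>" by blast
    then show ?thesis by (intro exI[of _ W] exI[of _ E]) (auto simp: comp_def)
  next
    case 2
    from 3(4)[OF 2 3(6)] obtain W E where "W \<subseteq> A" "finite W" "finite E" "card W + card E \<le> fo_size \<psi>"
      "E \<subseteq> (W \<union> s ` free_vars \<psi>) \<times> (W \<union> s ` free_vars \<psi>)"
      "\<forall>(B :: 'b set) r' h. collapse A r E B r' h \<longrightarrow> sat B r' (h \<circ> s) \<psi>" by blast
    then show ?thesis by (intro exI[of _ W] exI[of _ E]) (auto simp: comp_def)
  qed
next
  case (4 \<phi> \<psi>)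
  then have "sat A r s \<phi>" "sat A r s \<psi>" by auto
  from 4(3)[OF this(1) 4(6)] 4(4)[OF this(2) 4(6)]
  obtain W E W' E' where *: "finite W" "finite E" "card W + card E \<le> fo_size \<phi>"
      "E \<subseteq> (W \<union> s ` free_vars \<phi>) \<times> (W \<union> s ` free_vars \<phi>)"
      "\<forall>(B :: 'b set) r' h. collapse A r E B r' h \<longrightarrow> sat B r' (h \<circ> s) \<phi>"
      "finite W'" "finite E'" "card W' + card E' \<le> fo_size \<psi>"
      "E' \<subseteq> (W' \<union> s ` free_vars \<psi>) \<times> (W' \<union> s ` free_vars \<psi>)"
      "\<forall>(B :: 'b set) r' h. collapse A r E' B r' h \<longrightarrow> sat B r' (h \<circ> s) \<psi>" "W \<subseteq> A" "W' \<subseteq> A" by metis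
  \<comment> \<open>Witnesses or pairs shared by the two conjuncts only lower the count.\<close>
  have "card (W \<union> W') + card (E \<union> E') \<le> fo_size (Conj \<phi> \<psi>)"
    using *(3,8) card_Un_le[of W W'] card_Un_le[of E E'] by simp
  moreover have "sat B r' (h \<circ> s) (Conj \<phi> \<psi>)" if "collapse A r (E \<union> E') B r' h"
    for B :: "'b set" and r' h
    using that *(5,10) by (auto simp: comp_def
        dest: collapse_antimono[where E' = E] collapse_antimono[where E' = E'])
  moreover have "E \<union> E' \<subseteq> (W \<union> W' \<union> s ` free_vars (Conj \<phi> \<psi>)) \<times>
      (W \<union> W' \<union> s ` free_vars (Conj \<phi> \<psi>))"
    using *(4,9) by auto
  moreover have "W \<union> W' \<subseteq> A" "finite (W \<union> W')" "finite (E \<union> E')"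
    using *(1,2,6,7,11,12) by auto
  ultimately show ?case by meson
next
  case (5 \<phi> j)
  then obtain a where a: "a \<in> A" "sat A r (s(j := a)) \<phi>" by auto
  have "range (s(j := a)) \<subseteq> A" using 5(4) a(1) by auto
  from 5(2)[OF a(2) this] obtain W E where *: "finite W" "finite E" "card W + card E \<le> fo_size \<phi>"
      "E \<subseteq> (W \<union> s(j := a) ` free_vars \<phi>) \<times> (W \<union> s(j := a) ` free_vars \<phi>)"
      "\<forall>(B :: 'b set) r' h. collapse A r E B r' h \<longrightarrow> sat B r' (h \<circ> s(j := a)) \<phi>" "W \<subseteq> A"
    by metis
  \<comment> \<open>The quantifier pays for \<open>a\<close>. With \<open>a\<close> in the witness
    set, endpoints that came from the variable \<open>j\<close>, now bound, stay covered.\<close>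
  have "card (insert a W) + card E \<le> fo_size (Exists j \<phi>)"
    using *(1,3) by (simp add: card_insert_if)
  moreover have "W \<union> s(j := a) ` free_vars \<phi> \<subseteq> insert a W \<union> s ` free_vars (Exists j \<phi>)"
    by auto
  with *(4) have "E \<subseteq> (insert a W \<union> s ` free_vars (Exists j \<phi>)) \<times>
      (insert a W \<union> s ` free_vars (Exists j \<phi>))"
    by (meson Sigma_mono subset_trans)
  moreover have "sat B r' (h \<circ> s) (Exists j \<phi>)" if "collapse A r E B r' h"
    for B :: "'b set" and r' h
  proof -
    have "sat B r' ((h \<circ> s)(j := h a)) \<phi>"
      using *(5) that by (simp add: fun_upd_comp)
    moreover have "h a \<in> B" using that a(1) by (auto simp: collapse_def)
    ultimately show ?thesis by auto
  qed
  moreover have "insert a W \<subseteq> A" "finite (insert a W)"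
    using *(1,6) a(1) by auto
  ultimately show ?case using *(2) by meson
qed

text \<open>For injective \<open>f\<close>, a copy of 0 < ... < m - 1 inside \<open>'a\<close>,
  where the universes of the models considered must lie.\<close>

definition initial_order :: "(nat \<Rightarrow> 'a) \<Rightarrow> nat \<Rightarrow> 'a rel" where
  "initial_order f m = {(f i, f j) | i j. i < j \<and> j < m}"

lemma initial_order_iff:
  "inj f \<Longrightarrow> (f i, f j) \<in> initial_order f m \<longleftrightarrow> i < j \<and> j < m"
  by (auto simp: initial_order_def inj_eq)

lemma linear_order_model_initial_order:
  assumes "inj f" "m > 0"
  shows "linear_order_model (f ` {..<m}) (initial_order f m)"
proof -
  have "trans (initial_order f m)"
  proof (rule transI)
    fix x y z assume "(x, y) \<in> initial_order f m" "(y, z) \<in> initial_order f m"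
    then obtain i j k l where "x = f i" "y = f j" "y = f k" "z = f l" "i < j" "k < l" "l < m"
      unfolding initial_order_def by blast
    moreover from this have "j = k" using assms(1) by (simp add: inj_eq)
    ultimately show "(x, z) \<in> initial_order f m"
      using assms(1) by (simp add: initial_order_iff)
  qed
  moreover have "irrefl (initial_order f m)"
    by (auto simp: irrefl_def initial_order_def inj_eq[OF assms(1)])
  moreover have "total_on (f ` {..<m}) (initial_order f m)"
    using assms(1) by (auto simp: total_on_def initial_order_iff) (metis linorder_neqE_nat)
  moreover have "initial_order f m \<subseteq> f ` {..<m} \<times> f ` {..<m}"
    by (auto simp: initial_order_def)
  ultimately show ?thesis
    using assms(2) by (auto simp: linear_order_model_def strict_linear_order_on_def)
qed

theorem corollary21:
  fixes n :: nat and \<phi> :: fo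
  assumes "infinite (UNIV :: 'a set)"
    and "n \<ge> 1"
    and "sentence \<phi>"
    and "existential \<phi>"
    and "expresses_length_at_least TYPE('a) n \<phi>"
  shows "fo_size \<phi> \<ge> 2 * n - 1"
proof (cases "n = 1")
  \<comment> \<open>Treated apart because the order of length n - 1 would be empty, hence not a
    model.\<close>
  case True
  have "fo_size \<phi> \<ge> 1" by (induction \<phi>) auto
  then show ?thesis using True by simp
next
  case False
  with assms(2) have n: "n \<ge> 2" by simp
  obtain f :: "nat \<Rightarrow> 'a" where f: "inj f"
    using assms(1) infinite_countable_subset by blast
  define g where "g = inv f"
  have g: "g (f i) = i" for i using f by (simp add: g_def)
  have true_iff: "true_in (f ` {..<m}) (initial_order f m) \<phi> \<longleftrightarrow> n \<le> m" if "m > 0" for m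
    using assms(5) linear_order_model_initial_order[OF f that] card_image[OF inj_on_subset[OF f]]
    by (auto simp: expresses_length_at_least_def length_at_least_def)
  \<comment> \<open>An arbitrary assignment into the order: without free variables in
    \<open>\<phi>\<close> its values give no endpoints, so all endpoints in \<open>E\<close> are
    witnesses.\<close>
  define s where "s = (\<lambda>i :: nat. f 0)"
  have s: "range s \<subseteq> f ` {..<n}" using n by (auto simp: s_def)
  have "sat (f ` {..<n}) (initial_order f n) s \<phi>"
    using true_iff[of n] n s by (auto simp: true_in_def)
  from existential_sat_support[OF assms(4) this s, where ?'b = 'a]
  obtain W E where W: "W \<subseteq> f ` {..<n}" and fin: "finite W" "finite E" and size: "card W + card E \<le> fo_size \<phi>"
    and E: "E \<subseteq> W \<times> W"
    and pres: "\<And>(B :: 'a set) r' h. collapse (f ` {..<n}) (initial_order f n) E B r' h \<Longrightarrow>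
      sat B r' (h \<circ> s) \<phi>"
    using assms(3) by (auto simp: sentence_def)
  have edge: "(f k, f (Suc k)) \<in> E \<or> (f (Suc k), f k) \<in> E" if k: "k < n - 1" for k
  proof (rule ccontr)
    assume not: "\<not> ?thesis"
    \<comment> \<open>Merges \<open>k\<close> with \<open>Suc k\<close> and shifts everything above
      down by one; strict order is lost only between these two.\<close>
    define c where "c i = (if i \<le> k then i else i - 1)" for i
    have c_less: "i < j" if "c i < c j" for i j
      using that by (auto simp: c_def split: if_splits)
    have c_less_iff: "c i < c j \<longleftrightarrow> i < j" if "{i, j} \<noteq> {k, Suc k}" for i j
      using that by (cases "i \<le> k"; cases "j \<le> k") (auto simp: c_def doubleton_eq_iff)
    have c_bound: "c i < n - 1" if "i < n" for i
      using that k by (auto simp: c_def)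
    have "collapse (f ` {..<n}) (initial_order f n) E (f ` {..<n - 1}) (initial_order f (n - 1))
      (f \<circ> c \<circ> g)"
      unfolding collapse_def
    proof (intro conjI ballI impI; (clarify | simp)?)
      fix i assume "i < n"
      then show "(f \<circ> c \<circ> g) (f i) \<in> f ` {..<n - 1}"
        using c_bound by (auto simp: g)
    next
      fix i j assume "i < n" "j < n" "((f \<circ> c \<circ> g) (f i), (f \<circ> c \<circ> g) (f j)) \<in> initial_order f (n - 1)"
      then show "(f i, f j) \<in> initial_order f n" by (auto simp: g initial_order_iff f c_less)
    next
      fix a b assume "(a, b) \<in> E"
      moreover from this obtain i j where ij: "i < n" "j < n" "a = f i" "b = f j"
        using E W by blast
      ultimately have "{i, j} \<noteq> {k, Suc k}" using not by (auto simp: doubleton_eq_iff)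
      then have "c i < c j \<longleftrightarrow> i < j" "c j < c i \<longleftrightarrow> j < i"
        using c_less_iff[of i j] c_less_iff[of j i] by (auto simp: insert_commute)
      then show "((a, b) \<in> initial_order f n \<longrightarrow>
          ((f \<circ> c \<circ> g) a, (f \<circ> c \<circ> g) b) \<in> initial_order f (n - 1)) \<and>
        (a \<noteq> b \<longrightarrow> (f \<circ> c \<circ> g) a \<noteq> (f \<circ> c \<circ> g) b)"
        using ij f c_bound[of i] c_bound[of j] by (auto simp: g initial_order_iff inj_eq)
    qed
    \<comment> \<open>Here n \<ge> 2 makes the shorter order nonempty, so it is a model of length
      below n.\<close>
    from true_in_sentenceI[OF assms(3) pres[OF this]] true_iff[of "n - 1"] n show False by simp
  qed
  \<comment> \<open>The smaller index recovers \<open>k\<close> from a compared neighbouring pair in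
    either orientation, so distinct \<open>k\<close> need distinct pairs.\<close>
  have "{..<n - 1} \<subseteq> (\<lambda>(a, b). min (g a) (g b)) ` E"
  proof
    fix k assume "k \<in> {..<n - 1}"
    with edge[of k] show "k \<in> (\<lambda>(a, b). min (g a) (g b)) ` E"
      by (force simp: g image_iff)
  qed
  then have "n - 1 \<le> card E"
    using surj_card_le[OF fin(2)] by fastforce
  \<comment> \<open>Position 0 is an endpoint of the first neighbouring pair, which exists as n
    \<ge> 2; any other position is the upper end of a pair.\<close>
  moreover have "f k \<in> W" if "k < n" for k
  proof (cases k)
    case 0
    then show ?thesis using edge[of 0] E n by auto
  next
    case (Suc l)
    with that have "l < n - 1" by simp
    then show ?thesis using edge[of l] E Suc by auto
  qed
  then have "card (f ` {..<n}) \<le> card W"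
    by (intro card_mono fin) auto
  then have "n \<le> card W" using card_image[OF inj_on_subset[OF f]] by simp
  ultimately show ?thesis using size by simp
qed

end
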